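(* Let $G$ be a Dedekind $\sigma$-complete $\ell$-group. Then there exist a set $X$, a $\sigma$-ideal $\mathcal{I}$ of subsets of $X$, and an injective $\sigma$-continuous $\ell$-morphism $\varphi\colon G\to\mathbb{R}^X/\mathcal{I}$.
   Context: A $\sigma$-ideal of subsets of $X$ is a family of subsets of $X$ containing $\emptyset$, closed under subsets and countable unions. $\mathbb{R}^X/\mathcal{I}$ is the quotient $\ell$-group of $\mathbb{R}^X$ (pointwise operations) by the congruence $f\sim g$ iff $\{x: f(x)\ne g(x)\}\in\mathcal{I}$. Dedekind $\sigma$-complete: every countable subset with an upper bound has a supremum; $\sigma$-continuous: preserves existing countable suprema. *)

theory Defs
  imports Complex_Main "HOL-Library.Countable_Set"
begin

definition is_sup_wrt :: "('b \<Rightarrow> 'b \<Rightarrow> bool) \<Rightarrow> 'b set \<Rightarrow> 'b set \<Rightarrow> 'b \<Rightarrow> bool" where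
  "is_sup_wrt le C S s \<longleftrightarrow> s \<in> C \<and> (\<forall>y\<in>S. le y s) \<and> (\<forall>u\<in>C. (\<forall>y\<in>S. le y u) \<longrightarrow> le s u)"

definition dedekind_sigma_complete :: "'a::order itself \<Rightarrow> bool" where
  "dedekind_sigma_complete _ \<longleftrightarrow>
     (\<forall>S::'a set. countable S \<and> S \<noteq> {} \<and> (\<exists>u. \<forall>y\<in>S. y \<le> u) \<longrightarrow>
        (\<exists>s. is_sup_wrt (\<le>) UNIV S s))"

definition sigma_ideal :: "'x set \<Rightarrow> 'x set set \<Rightarrow> bool" where
  "sigma_ideal X I \<longleftrightarrow> I \<subseteq> Pow X \<and> {} \<in> I \<and>
     (\<forall>A\<in>I. \<forall>B. B \<subseteq> A \<longrightarrow> B \<in> I) \<and>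
     (\<forall>F. countable F \<and> F \<subseteq> I \<longrightarrow> \<Union>F \<in> I)"

text \<open>The quotient R^X / I: the class of f : X -> R (values outside X are irrelevant).\<close>
definition qclass :: "'x set \<Rightarrow> 'x set set \<Rightarrow> ('x \<Rightarrow> real) \<Rightarrow> ('x \<Rightarrow> real) set" where
  "qclass X I f = {g. {x\<in>X. f x \<noteq> g x} \<in> I}"

definition quot :: "'x set \<Rightarrow> 'x set set \<Rightarrow> ('x \<Rightarrow> real) set set" where
  "quot X I = range (qclass X I)"

definition qle :: "'x set \<Rightarrow> 'x set set \<Rightarrow> ('x \<Rightarrow> real) set \<Rightarrow> ('x \<Rightarrow> real) set \<Rightarrow> bool" where
  "qle X I A B \<longleftrightarrow> (\<exists>f g. A = qclass X I f \<and> B = qclass X I g \<and> {x\<in>X. g x < f x} \<in> I)"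

definition l_morphism :: "'x set \<Rightarrow> 'x set set \<Rightarrow> ('a::{group_add,lattice} \<Rightarrow> ('x \<Rightarrow> real) set) \<Rightarrow> bool" where
  "l_morphism X I \<phi> \<longleftrightarrow> (\<forall>a. \<phi> a \<in> quot X I) \<and>
     (\<forall>a b f g. f \<in> \<phi> a \<longrightarrow> g \<in> \<phi> b \<longrightarrow>
        \<phi> (a + b) = qclass X I (\<lambda>x. f x + g x) \<and>
        \<phi> (sup a b) = qclass X I (\<lambda>x. max (f x) (g x)) \<and>
        \<phi> (inf a b) = qclass X I (\<lambda>x. min (f x) (g x)))"

definition sigma_continuous :: "'x set \<Rightarrow> 'x set set \<Rightarrow> ('a::order \<Rightarrow> ('x \<Rightarrow> real) set) \<Rightarrow> bool" where
  "sigma_continuous X I \<phi> \<longleftrightarrow>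
     (\<forall>S s. countable S \<and> S \<noteq> {} \<and> is_sup_wrt (\<le>) UNIV S s \<longrightarrow>
        is_sup_wrt (qle X I) (quot X I) (\<phi> ` S) (\<phi> s))"

end

(*
  Let X be the set of all functions x : G -> R, and let I be the sigma-ideal generated by the sets
  of those x that violate one instance of the homomorphism laws, or fail to preserve one countable
  supremum of G. Modulo I, evaluation a |-> (x |-> x a) is a sigma-continuous l-morphism by
  construction; the point is its injectivity: given countably many laws and a, b with not a <= b,
  some x satisfies all of these laws and x b < x a.

  Such an x is found by a Rasiowa-Sikorski argument. The laws involve a countable subgroup H of G.
  Choose a decreasing sequence of p n > 0 below the positive part of a - b that meets countably many
  dense sets, and let c be below d if some p n is disjoint from the positive part of c - d.
  Disjointness is invariant under conjugation because G is Archimedean, so this preorder is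
  translation invariant, although commutativity of G is not yet known; genericity makes it total and
  Archimedean on H, and Hoelder's theorem turns it into a real-valued homomorphism, which
  genericity also makes continuous along the given suprema.
*)

theory Submission
  imports Defs
begin

section \<open>Multiples in a group\<close>

primrec nmul :: "nat \<Rightarrow> 'a::group_add \<Rightarrow> 'a" where
  "nmul 0 a = 0"
| "nmul (Suc n) a = a + nmul n a"

lemma nmul_add: "nmul (m + n) a = nmul m a + nmul n a"
  by (induction m) (simp_all add: add.assoc)

lemma nmul_Suc_right: "nmul (Suc n) a = nmul n a + a"
  using nmul_add[of n "Suc 0" a] by simp

lemma nmul_zero: "nmul n 0 = 0"
  by (induction n) simp_all

lemma nmul_conj: "nmul n (b + a - b) = b + nmul n a - b"
  by (induction n) (simp_all add: add.assoc diff_conv_add_uminus del: add_uminus_conv_diff)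

definition zmul :: "int \<Rightarrow> 'a::group_add \<Rightarrow> 'a" where
  "zmul k a = (if 0 \<le> k then nmul (nat k) a else - nmul (nat (- k)) a)"

lemma zmul_0 [simp]: "zmul 0 a = 0"
  by (simp add: zmul_def)

lemma zmul_plus_1: "zmul (k + 1) a = zmul k a + a"
proof (cases "0 \<le> k")
  case True
  then have "nat (k + 1) = Suc (nat k)" by simp
  with True show ?thesis
    by (simp add: zmul_def nmul_Suc_right del: nmul.simps)
next
  case False
  then have eq: "nat (- k) = Suc (nat (- (k + 1)))" by simp
  have "zmul (k + 1) a = - nmul (nat (- (k + 1))) a"
    using False by (cases "k = - 1") (auto simp: zmul_def)
  moreover have "zmul k a = - nmul (nat (- (k + 1))) a - a"
    using False unfolding zmul_def eq by (simp add: minus_add)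
  ultimately show ?thesis by simp
qed

lemma zmul_1 [simp]: "zmul 1 a = a"
  using zmul_plus_1[of 0 a] by simp

lemma zmul_add: "zmul (k + l) a = zmul k a + zmul l a"
proof (induction l rule: int_induct[where k = 0])
  case base
  show ?case by simp
next
  case (step1 i)
  have "zmul (k + (i + 1)) a = zmul (k + i) a + a"
    using zmul_plus_1[of "k + i" a] by (simp add: add.assoc)
  with step1 show ?case by (simp add: zmul_plus_1 add.assoc)
next
  case (step2 i)
  have "zmul (k + i) a = zmul (k + (i - 1)) a + a" "zmul i a = zmul (i - 1) a + a"
    using zmul_plus_1[of "k + (i - 1)" a] zmul_plus_1[of "i - 1" a] by (simp_all add: add.assoc)
  with step2 have "zmul (k + (i - 1)) a + a = (zmul k a + zmul (i - 1) a) + a"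
    by (simp add: add.assoc)
  then show ?case by (simp only: add_right_cancel)
qed

lemma zmul_of_nat: "zmul (int n) a = nmul n a"
  by (simp add: zmul_def)

lemma zmul_minus: "zmul (- k) a = - zmul k a"
  using zmul_add[of "- k" k a] by (simp add: eq_neg_iff_add_eq_0)

section \<open>Hoelder's theorem\<close>

text \<open>Translation invariance holds on the whole group, totality and the Archimedean property
  only on \<open>H\<close>, which in the application is the countable part decided by a generic
  sequence. Antisymmetry is absent, so the real-valued homomorphism may have a kernel.\<close>

locale archimedean_preordered_group =
  fixes le :: "'a::group_add \<Rightarrow> 'a \<Rightarrow> bool" (infix "\<preceq>" 50)
    and H :: "'a set" and u :: 'a
  assumes le_refl: "a \<preceq> a"
    and le_trans [trans]: "a \<preceq> b \<Longrightarrow> b \<preceq> c \<Longrightarrow> a \<preceq> c"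
    and le_left: "a \<preceq> b \<Longrightarrow> c + a \<preceq> c + b"
    and le_right: "a \<preceq> b \<Longrightarrow> a + c \<preceq> b + c"
    and zero_H: "0 \<in> H"
    and add_H: "a \<in> H \<Longrightarrow> b \<in> H \<Longrightarrow> a + b \<in> H"
    and minus_H: "a \<in> H \<Longrightarrow> - a \<in> H"
    and total_H: "a \<in> H \<Longrightarrow> b \<in> H \<Longrightarrow> a \<preceq> b \<or> b \<preceq> a"
    and arch_H: "a \<in> H \<Longrightarrow> b \<in> H \<Longrightarrow> \<not> a \<preceq> 0 \<Longrightarrow> \<exists>n. b \<preceq> nmul n a"
    and u_H: "u \<in> H" and u_pos: "\<not> u \<preceq> 0"
begin

lemma le_add: "a \<preceq> b \<Longrightarrow> c \<preceq> d \<Longrightarrow> a + c \<preceq> b + d"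
  using le_left le_right le_trans by blast

lemma le_left_cancel: "c + a \<preceq> c + b \<Longrightarrow> a \<preceq> b"
  using le_left[of "c + a" "c + b" "- c"] by (simp add: add.assoc[symmetric])

lemma le_minus: "a \<preceq> b \<Longrightarrow> - b \<preceq> - a"
  using le_right[OF le_left[of a b "- b"], of "- a"] by (simp add: add.assoc)

lemma nmul_H: "a \<in> H \<Longrightarrow> nmul n a \<in> H"
  by (induction n) (auto intro: zero_H add_H)

lemma zmul_H: "a \<in> H \<Longrightarrow> zmul k a \<in> H"
  by (auto simp: zmul_def intro: nmul_H minus_H)

lemma nmul_mono: "a \<preceq> b \<Longrightarrow> nmul n a \<preceq> nmul n b"
  by (induction n) (auto intro: le_refl le_add)

lemma u_ge_0: "0 \<preceq> u"
  using total_H[OF zero_H u_H] u_pos by blast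

lemma zmul_mono:
  assumes "k \<le> l"
  shows "zmul k u \<preceq> zmul l u"
proof -
  have "0 \<preceq> zmul (l - k) u"
    using nmul_mono[OF u_ge_0, of "nat (l - k)"] assms by (simp add: zmul_def nmul_zero)
  from le_left[OF this, of "zmul k u"] show ?thesis
    by (simp flip: zmul_add)
qed

section \<open>Integer parts with respect to the unit \<open>u\<close>\<close>

lemma ex_floor:
  assumes "h \<in> H"
  shows "\<exists>k. zmul k u \<preceq> h \<and> \<not> zmul (k + 1) u \<preceq> h"
proof -
  obtain n where "- h \<preceq> nmul n u"
    using arch_H[OF u_H minus_H[OF assms] u_pos] by blast
  from le_minus[OF this] have lo: "zmul (- int n) u \<preceq> h"
    by (simp add: zmul_minus zmul_of_nat)
  obtain m where m: "h \<preceq> nmul m u"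
    using arch_H[OF u_H assms u_pos] by blast
  have "\<not> zmul (int m + 1) u \<preceq> h"
  proof
    assume "zmul (int m + 1) u \<preceq> h"
    from le_trans[OF this m] have "zmul (int m) u + u \<preceq> zmul (int m) u + 0"
      by (simp add: zmul_plus_1 zmul_of_nat)
    then show False using le_left_cancel u_pos by blast
  qed
  then have ex: "\<exists>j::nat. \<not> zmul (- int n + int j) u \<preceq> h"
    by (intro exI[of _ "n + m + 1"]) (simp add: add.commute[of 1])
  \<comment> \<open>The multiples of \<open>u\<close> are scanned upwards from
    \<open>- int n\<close>; the last one before the first failure is the integer part.\<close>
  define j where "j = (LEAST j::nat. \<not> zmul (- int n + int j) u \<preceq> h)"
  have j: "\<not> zmul (- int n + int j) u \<preceq> h"
    unfolding j_def using ex by (rule LeastI_ex)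
  with lo obtain i where i: "j = Suc i" by (cases j) auto
  have "zmul (- int n + int i) u \<preceq> h"
    using not_less_Least[of i "\<lambda>j. \<not> zmul (- int n + int j) u \<preceq> h"] i j_def by auto
  with j i show ?thesis
    by (intro exI[of _ "- int n + int i"]) (simp add: algebra_simps)
qed

definition flr :: "'a \<Rightarrow> int" where
  "flr h = (SOME k. zmul k u \<preceq> h \<and> \<not> zmul (k + 1) u \<preceq> h)"

lemma flr:
  assumes "h \<in> H"
  shows "zmul (flr h) u \<preceq> h" "\<not> zmul (flr h + 1) u \<preceq> h"
  using someI_ex[OF ex_floor[OF assms]] unfolding flr_def by blast+

lemma flr_greatest: "h \<in> H \<Longrightarrow> zmul k u \<preceq> h \<Longrightarrow> k \<le> flr h"
  using flr(2)[of h] le_trans[OF zmul_mono[of "flr h + 1" k]] by (cases "k \<le> flr h") auto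

lemma flr_mono: "a \<in> H \<Longrightarrow> b \<in> H \<Longrightarrow> a \<preceq> b \<Longrightarrow> flr a \<le> flr b"
  using flr_greatest flr(1) le_trans by blast

lemma flr_0: "flr 0 = 0"
proof -
  have "0 \<le> flr 0" by (rule flr_greatest) (auto intro: zero_H le_refl)
  moreover have "flr 0 < 1"
    using le_trans[OF zmul_mono[of 1 "flr 0"] flr(1)[OF zero_H]] u_pos by (cases "flr 0 < 1") auto
  ultimately show ?thesis by simp
qed

text \<open>Multiples of \<open>u\<close> add up without commuting anything past \<open>a\<close> or
  \<open>b\<close>; cancelling \<open>zmul (flr a + 1) u\<close> on the left bounds the defect by
  1.\<close>

lemma flr_add:
  assumes "a \<in> H" "b \<in> H"
  shows "flr a + flr b \<le> flr (a + b)" "flr (a + b) \<le> flr a + flr b + 1"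
proof -
  show "flr a + flr b \<le> flr (a + b)"
    by (rule flr_greatest) (auto simp: zmul_add intro: add_H assms le_add flr)
  show "flr (a + b) \<le> flr a + flr b + 1"
  proof (rule ccontr)
    assume "\<not> ?thesis"
    then have "zmul ((flr a + 1) + (flr b + 1)) u \<preceq> zmul (flr (a + b)) u"
      by (intro zmul_mono) simp
    then have 1: "zmul (flr a + 1) u + zmul (flr b + 1) u \<preceq> a + b"
      using le_trans flr(1)[OF add_H[OF assms]] unfolding zmul_add[of "flr a + 1"] by blast
    have "a \<preceq> zmul (flr a + 1) u"
      using total_H[OF \<open>a \<in> H\<close> zmul_H[OF u_H]] flr(2)[OF \<open>a \<in> H\<close>] by blast
    from le_trans[OF 1 le_right[OF this]] show False
      using le_left_cancel flr(2)[OF \<open>b \<in> H\<close>] by blast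
  qed
qed

lemma flr_nmul:
  assumes "a \<in> H"
  shows "int k * flr (nmul n a) \<le> flr (nmul (k * n) a)"
    "flr (nmul (k * n) a) \<le> int k * flr (nmul n a) + int k"
proof (induction k)
  case 0
  { case 1 then show ?case by (simp add: flr_0) }
  { case 2 then show ?case by (simp add: flr_0) }
next
  case (Suc k)
  note b = flr_add[OF nmul_H[OF assms, of n] nmul_H[OF assms, of "k * n"]]
  { case 1 then show ?case using Suc b by (simp add: nmul_add algebra_simps) }
  { case 2 then show ?case using Suc b by (simp add: nmul_add algebra_simps) }
qed

section \<open>The homomorphism as a limit of integer parts\<close>

text \<open>The limit of \<open>flr (nmul n a) / n\<close>, as in the homogenization of a
  quasimorphism. By superadditivity it equals the supremum, a form that gives the bounds below
  directly.\<close>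

definition val :: "'a \<Rightarrow> real" where
  "val a = (SUP n\<in>{0<..}. real_of_int (flr (nmul n a)) / real n)"

lemma val_bounds:
  assumes "a \<in> H"
  shows "real_of_int (flr (nmul n a)) \<le> real n * val a"
    "real n * val a \<le> real_of_int (flr (nmul n a)) + 1"
proof -
  let ?r = "\<lambda>n. real_of_int (flr (nmul n a))"
  \<comment> \<open>Both quotients are compared with the integer part of the common multiple
    \<open>nmul (m * n) a\<close>.\<close>
  have *: "?r n / real n \<le> (?r m + 1) / real m" if "0 < n" "0 < m" for m n
  proof -
    have "int m * flr (nmul n a) \<le> int n * flr (nmul m a) + int n"
      using flr_nmul(1)[OF assms, where k = m and n = n]
        flr_nmul(2)[OF assms, where k = n and n = m] by (simp add: mult.commute)
    then have "real_of_int (int m * flr (nmul n a)) \<le> real_of_int (int n * flr (nmul m a) + int n)"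
      by (simp only: of_int_le_iff)
    with that show ?thesis by (simp add: field_simps)
  qed
  have bdd: "bdd_above ((\<lambda>n. ?r n / real n) ` {0<..})"
    by (rule bdd_aboveI[of _ "?r 1 + 1"]) (use *[of _ 1] in auto)
  have "?r n \<le> real n * val a \<and> real n * val a \<le> ?r n + 1"
  proof (cases "n = 0")
    case True
    then show ?thesis by (simp add: flr_0)
  next
    case False
    then have "?r n / real n \<le> val a"
      unfolding val_def by (intro cSUP_upper bdd) simp
    moreover have "val a \<le> (?r n + 1) / real n"
      unfolding val_def by (intro cSUP_least) (use False * in auto)
    ultimately show ?thesis using False by (simp add: field_simps)
  qed
  then show "?r n \<le> real n * val a" "real n * val a \<le> ?r n + 1" by auto
qed

text \<open>The group need not commute, but if \<open>a + b \<preceq> b + a\<close> then \<open>n(a + b)\<close> lies between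
  \<open>na + nb\<close> and \<open>nb + na\<close>, and the integer part does not distinguish these up to 1.\<close>

lemma nmul_swap1:
  assumes "a + b \<preceq> b + a"
  shows "a + nmul n b \<preceq> nmul n b + a"
proof (induction n)
  case 0 then show ?case by (simp add: le_refl)
next
  case (Suc n)
  have "a + nmul (Suc n) b = (a + b) + nmul n b" by (simp add: add.assoc)
  also have "\<dots> \<preceq> (b + a) + nmul n b" using assms by (rule le_right)
  also have "\<dots> = b + (a + nmul n b)" by (simp add: add.assoc)
  also have "\<dots> \<preceq> b + (nmul n b + a)" using Suc by (rule le_left)
  also have "\<dots> = nmul (Suc n) b + a" by (simp add: add.assoc)
  finally show ?case .
qed

lemma nmul_swap2:
  assumes "a + b \<preceq> b + a"
  shows "nmul n a + b \<preceq> b + nmul n a"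
proof (induction n)
  case 0 then show ?case by (simp add: le_refl)
next
  case (Suc n)
  have "nmul (Suc n) a + b = a + (nmul n a + b)" by (simp add: add.assoc)
  also have "\<dots> \<preceq> a + (b + nmul n a)" using Suc by (rule le_left)
  also have "\<dots> = (a + b) + nmul n a" by (simp add: add.assoc)
  also have "\<dots> \<preceq> (b + a) + nmul n a" using assms by (rule le_right)
  also have "\<dots> = b + nmul (Suc n) a" by (simp add: add.assoc)
  finally show ?case .
qed

lemma nmul_add_ge:
  assumes "a + b \<preceq> b + a"
  shows "nmul n a + nmul n b \<preceq> nmul n (a + b)"
proof (induction n)
  case 0 then show ?case by (simp add: le_refl)
next
  case (Suc n)
  have "nmul (Suc n) a + nmul (Suc n) b = a + (nmul n a + b) + nmul n b" by (simp add: add.assoc)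
  also have "\<dots> \<preceq> a + (b + nmul n a) + nmul n b"
    by (rule le_right[OF le_left[OF nmul_swap2[OF assms]]])
  also have "\<dots> = (a + b) + (nmul n a + nmul n b)" by (simp add: add.assoc)
  also have "\<dots> \<preceq> (a + b) + nmul n (a + b)" using Suc by (rule le_left)
  finally show ?case by simp
qed

lemma nmul_add_le:
  assumes "b + a \<preceq> a + b"
  shows "nmul n (a + b) \<preceq> nmul n a + nmul n b"
proof (induction n)
  case 0 then show ?case by (simp add: le_refl)
next
  case (Suc n)
  have "nmul (Suc n) (a + b) = (a + b) + nmul n (a + b)" by simp
  also have "\<dots> \<preceq> (a + b) + (nmul n a + nmul n b)" using Suc by (rule le_left)
  also have "\<dots> = a + (b + nmul n a) + nmul n b" by (simp add: add.assoc)
  also have "\<dots> \<preceq> a + (nmul n a + b) + nmul n b"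
    by (rule le_right[OF le_left[OF nmul_swap1[OF assms]]])
  also have "\<dots> = nmul (Suc n) a + nmul (Suc n) b" by (simp add: add.assoc)
  finally show ?case .
qed

lemma nmul_add_bounds:
  assumes "a \<in> H" "b \<in> H"
  shows "(nmul n a + nmul n b \<preceq> nmul n (a + b) \<and> nmul n (a + b) \<preceq> nmul n b + nmul n a)
    \<or> (nmul n b + nmul n a \<preceq> nmul n (a + b) \<and> nmul n (a + b) \<preceq> nmul n a + nmul n b)"
proof (cases "a + b \<preceq> b + a")
  case True
  have "nmul n (a + b) \<preceq> nmul n (b + a)" by (rule nmul_mono[OF True])
  with nmul_add_ge[OF True] nmul_add_le[OF True] show ?thesis
    using le_trans by blast
next
  case False
  then have *: "b + a \<preceq> a + b" using total_H add_H assms by blast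
  have "nmul n (b + a) \<preceq> nmul n (a + b)" by (rule nmul_mono[OF *])
  with nmul_add_ge[OF *] nmul_add_le[OF *] show ?thesis
    using le_trans by blast
qed

lemma val_add:
  assumes H: "a \<in> H" "b \<in> H"
  shows "val (a + b) = val a + val b"
proof -
  have bnd: "\<bar>flr (nmul n (a + b)) - flr (nmul n a) - flr (nmul n b)\<bar> \<le> 1" for n
  proof -
    note HH = nmul_H[OF H(1), of n] nmul_H[OF H(2), of n] nmul_H[OF add_H[OF H], of n]
    note nmul_add_bounds[OF H, of n]
    moreover note flr_add[OF HH(1,2)] flr_add[OF HH(2,1)]
      flr_mono[OF add_H[OF HH(1,2)] HH(3)] flr_mono[OF HH(3) add_H[OF HH(2,1)]]
      flr_mono[OF add_H[OF HH(2,1)] HH(3)] flr_mono[OF HH(3) add_H[OF HH(1,2)]]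
    ultimately show ?thesis by linarith
  qed
  \<comment> \<open>The bound 4 consists of 1 from \<open>bnd\<close> and 1 from each of the three
    instances of \<open>val_bounds\<close>; it is independent of \<open>n\<close>.\<close>
  have "real n * \<bar>val (a + b) - val a - val b\<bar> \<le> 4" for n
  proof -
    have "\<bar>real_of_int (flr (nmul n (a + b))) - flr (nmul n a) - flr (nmul n b)\<bar> \<le> 1"
      using bnd[of n] by linarith
    moreover note val_bounds[OF H(1), of n] val_bounds[OF H(2), of n] val_bounds[OF add_H[OF H], of n]
    ultimately have "\<bar>real n * val (a + b) - real n * val a - real n * val b\<bar> \<le> 4"
      by linarith
    moreover have "real n * \<bar>val (a + b) - val a - val b\<bar>
        = \<bar>real n * (val (a + b) - val a - val b)\<bar>" by (simp add: abs_mult)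
    ultimately show ?thesis by (simp add: algebra_simps)
  qed
  then have "\<bar>val (a + b) - val a - val b\<bar> = 0"
    by (intro real_archimedian_rdiv_eq_0[of _ 4]) auto
  then show ?thesis by simp
qed

lemma val_minus: "a \<in> H \<Longrightarrow> val (- a) = - val a"
  using val_add[of a "- a"] val_add[of 0 0] minus_H zero_H by simp

lemma val_mono:
  assumes "a \<in> H" "b \<in> H" "a \<preceq> b"
  shows "val a \<le> val b"
proof -
  have "0 \<preceq> - a + b" using le_left[OF assms(3), of "- a"] by simp
  then have "flr 0 \<le> flr (- a + b)"
    by (intro flr_mono zero_H add_H minus_H assms)
  then have "0 \<le> val (- a + b)"
    using val_bounds(1)[of "- a + b" 1] add_H minus_H assms by (simp add: flr_0)
  then show ?thesis
    using val_add[of "- a" b] val_minus minus_H assms by simp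
qed

text \<open>Some multiple of \<open>a\<close> lies above \<open>u\<close> and so has integer part at
  least 1.\<close>

lemma val_pos:
  assumes "a \<in> H" "\<not> a \<preceq> 0"
  shows "0 < val a"
proof -
  obtain n where n: "u \<preceq> nmul n a" using arch_H[OF assms(1) u_H assms(2)] by blast
  then have "1 \<le> flr (nmul n a)"
    by (intro flr_greatest nmul_H assms) simp
  then have "1 \<le> real n * val a"
    using val_bounds(1)[OF assms(1), of n] by linarith
  then have "0 < real n * val a" by linarith
  then show ?thesis by (simp add: zero_less_mult_iff)
qed

theorem val_le_iff:
  assumes "a \<in> H" "b \<in> H"
  shows "val a \<le> val b \<longleftrightarrow> a \<preceq> b"
proof
  assume "val a \<le> val b"
  show "a \<preceq> b"
  proof (rule ccontr)
    assume "\<not> a \<preceq> b"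
    then have "\<not> - b + a \<preceq> 0"
      using le_left[of "- b + a" 0 b] by (auto simp: add.assoc[symmetric])
    then have "0 < val (- b + a)" by (intro val_pos add_H minus_H assms)
    with \<open>val a \<le> val b\<close> show False
      using val_add[of "- b" a] val_minus minus_H assms by simp
  qed
qed (rule val_mono[OF assms])

end

section \<open>Lattice-ordered groups\<close>

text \<open>The type classes do not relate order and addition. Monotonicity is assumed on both sides
  because addition need not commute.\<close>

locale l_group =
  fixes ty :: "'a::{group_add,lattice} itself"
  assumes left_mono: "\<And>a b c :: 'a. a \<le> b \<Longrightarrow> c + a \<le> c + b"
    and right_mono: "\<And>a b c :: 'a. a \<le> b \<Longrightarrow> a + c \<le> b + c"
begin

section \<open>Order and lattice operations under translation and negation\<close>

lemma add_le_left_iff [simp]: "c + a \<le> c + b \<longleftrightarrow> a \<le> b" for a b c :: 'a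
  using left_mono[of a b c] left_mono[of "c + a" "c + b" "- c"]
  by (auto simp: add.assoc[symmetric])

lemma add_le_right_iff [simp]: "a + c \<le> b + c \<longleftrightarrow> a \<le> b" for a b c :: 'a
  using right_mono[of a b c] right_mono[of "a + c" "b + c" "- c"]
  by (auto simp: add.assoc)

lemma add_mono': "a \<le> b \<Longrightarrow> c \<le> d \<Longrightarrow> a + c \<le> b + d" for a b c d :: 'a
  using left_mono right_mono order.trans by blast

lemma minus_le_iff' [simp]: "- a \<le> - b \<longleftrightarrow> b \<le> a" for a b :: 'a
proof -
  have "a + - a + b \<le> a + - b + b \<longleftrightarrow> - a \<le> - b"
    by (simp only: add_le_left_iff add_le_right_iff)
  then show ?thesis by simp
qed

lemma minus_le_swap: "- a \<le> b \<longleftrightarrow> - b \<le> a" for a b :: 'a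
  using minus_le_iff'[of a "- b"] by simp

lemma neg_le_0_iff [simp]: "- a \<le> 0 \<longleftrightarrow> 0 \<le> a" and neg_ge_0_iff [simp]: "0 \<le> - a \<longleftrightarrow> a \<le> 0" for a :: 'a
  using minus_le_iff'[of a 0] minus_le_iff'[of 0 a] by simp_all

lemma le_diff_iff': "c \<le> a - b \<longleftrightarrow> c + b \<le> a" for a b c :: 'a
  using add_le_right_iff[of c b "a - b"] by simp

lemma diff_le_iff': "a - b \<le> c \<longleftrightarrow> a \<le> c + b" for a b c :: 'a
  using add_le_right_iff[of "a - b" b c] by simp

lemma minus_add_le_iff: "- b + a \<le> c \<longleftrightarrow> a \<le> b + c" for a b c :: 'a
  using add_le_left_iff[of b "- b + a" c] by (simp add: add.assoc[symmetric] del: add_le_left_iff)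

lemma le_minus_add_iff: "c \<le> - b + a \<longleftrightarrow> b + c \<le> a" for a b c :: 'a
  using add_le_left_iff[of b c "- b + a"] by (simp add: add.assoc[symmetric] del: add_le_left_iff)

lemma add_sup: "c + sup a b = sup (c + a) (c + b)" for a b c :: 'a
proof (rule order.antisym)
  have "sup a b \<le> - c + sup (c + a) (c + b)"
    by (intro sup_least) (simp_all add: le_minus_add_iff)
  then show "c + sup a b \<le> sup (c + a) (c + b)" by (simp only: le_minus_add_iff)
qed simp

lemma sup_add: "sup a b + c = sup (a + c) (b + c)" for a b c :: 'a
proof (rule order.antisym)
  have "sup a b \<le> sup (a + c) (b + c) - c"
    by (intro sup_least) (simp_all add: le_diff_iff')
  then show "sup a b + c \<le> sup (a + c) (b + c)" by (simp only: le_diff_iff')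
qed simp

lemma add_inf: "c + inf a b = inf (c + a) (c + b)" for a b c :: 'a
proof (rule order.antisym)
  have "- c + inf (c + a) (c + b) \<le> inf a b"
    by (intro inf_greatest) (simp_all add: minus_add_le_iff)
  then show "inf (c + a) (c + b) \<le> c + inf a b" by (simp only: minus_add_le_iff)
qed simp

lemma inf_add: "inf a b + c = inf (a + c) (b + c)" for a b c :: 'a
proof (rule order.antisym)
  have "inf (a + c) (b + c) - c \<le> inf a b"
    by (intro inf_greatest) (simp_all add: diff_le_iff')
  then show "inf (a + c) (b + c) \<le> inf a b + c" by (simp only: diff_le_iff')
qed simp

lemma minus_inf: "- inf a b = sup (- a) (- b)" for a b :: 'a
proof (rule order.antisym)
  have "- sup (- a) (- b) \<le> inf a b"
    by (intro inf_greatest) (simp_all only: minus_le_swap sup_ge1 sup_ge2)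
  then show "- inf a b \<le> sup (- a) (- b)" by (simp only: minus_le_swap)
qed simp

lemma conj_mono: "a \<le> b \<Longrightarrow> c + a - c \<le> c + b - c" for a b c :: 'a
  using right_mono[OF left_mono[of a b c], of "- c"] by simp

lemma conj_inf: "c + inf a b - c = inf (c + a - c) (c + b - c)" for a b c :: 'a
  using inf_add[of "c + a" "c + b" "- c"] by (simp add: add_inf)

lemma conj_sup: "c + sup a b - c = sup (c + a - c) (c + b - c)" for a b c :: 'a
  using sup_add[of "c + a" "c + b" "- c"] by (simp add: add_sup)

section \<open>Positive parts\<close>

definition pp :: "'a \<Rightarrow> 'a" where
  "pp a = sup a 0"

lemma pp_nonneg [simp]: "0 \<le> pp a" and pp_ge [simp]: "a \<le> pp a"
  by (simp_all add: pp_def)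

lemma pp_mono: "a \<le> b \<Longrightarrow> pp a \<le> pp b"
  by (simp add: pp_def le_supI1)

lemma pp_eq: "0 \<le> a \<Longrightarrow> pp a = a"
  by (simp add: pp_def sup_absorb1)

lemma pp_eq_0_iff: "pp a = 0 \<longleftrightarrow> a \<le> 0"
  by (auto simp: pp_def sup_absorb2 le_iff_sup)

lemma pp_conj: "pp (c + a - c) = c + pp a - c"
  by (simp add: pp_def conj_sup)

lemma pp_diff: "pp a - a = pp (- a)"
  using sup_add[of a 0 "- a"] by (simp add: pp_def sup_commute)

lemma pp_add_le: "pp (a + b) \<le> pp a + pp b"
  unfolding pp_def[of "a + b"] using add_mono'[of 0 "pp a" 0 "pp b"] add_mono'[of a "pp a" b "pp b"]
  by simp

lemma inf_pp_pp_minus: "inf (pp a) (pp (- a)) = 0"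
proof -
  have "pp a = pp (- a) + a" by (simp flip: pp_diff)
  then have "inf (pp a) (pp (- a)) = pp (- a) + inf a 0"
    by (simp add: add_inf)
  also have "inf a 0 = - pp (- a)"
    using arg_cong[OF minus_inf[of a 0], of uminus] by (simp add: pp_def)
  finally show ?thesis by simp
qed

section \<open>Disjoint elements\<close>

lemma inf_0_mono: "inf p u = 0 \<Longrightarrow> 0 \<le> q \<Longrightarrow> q \<le> p \<Longrightarrow> 0 \<le> v \<Longrightarrow> v \<le> u \<Longrightarrow> inf q v = 0" for p u q v :: 'a
  by (rule order.antisym) (auto dest: inf_mono[of q p v u])

text \<open>Let \<open>z\<close> be the meet. Then \<open>- u + z\<close> is below \<open>v\<close>,
  and below \<open>p\<close> because \<open>u\<close> is positive, hence below 0. So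
  \<open>z\<close> is below both \<open>u\<close> and \<open>p\<close>.\<close>

lemma inf_add_0:
  fixes p u v :: 'a
  assumes "inf p u = 0" "inf p v = 0"
  shows "inf p (u + v) = 0"
proof (rule order.antisym)
  define z where "z = inf p (u + v)"
  have nn: "0 \<le> p" "0 \<le> u" "0 \<le> v" using assms by (metis inf_le1 inf_le2)+
  have "0 \<le> u + v" using add_mono'[OF nn(2,3)] by simp
  with nn show "0 \<le> inf p (u + v)" by simp
  have "- u + z \<le> z" using add_le_right_iff[of "- u" z 0] nn(2) by (simp del: add_le_right_iff)
  also have "z \<le> p" by (simp add: z_def)
  finally have "- u + z \<le> inf p v" by (simp add: minus_add_le_iff z_def)
  then have "z \<le> u" using assms(2) by (simp add: minus_add_le_iff)
  then have "z \<le> inf p u" by (simp add: z_def)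
  with assms(1) show "inf p (u + v) \<le> 0" by (simp add: z_def)
qed

lemma nmul_mono': "a \<le> b \<Longrightarrow> nmul n a \<le> nmul n b" for a b :: 'a
  by (induction n) (simp_all add: add_mono')

lemma nmul_nonneg: "0 \<le> a \<Longrightarrow> 0 \<le> nmul n a" for a :: 'a
  using nmul_mono'[of 0 a n] by (simp add: nmul_zero)

lemma inf_nmul_0: "inf p u = 0 \<Longrightarrow> inf p (nmul n u) = 0" for p u :: 'a
proof (induction n)
  case 0
  then have "0 \<le> p" by (metis inf_le1)
  then show ?case by (simp add: inf_absorb2)
qed (simp add: inf_add_0)

lemma inf_nmul_nmul_0: "inf p u = 0 \<Longrightarrow> inf (nmul m p) (nmul n u) = 0" for p u :: 'a
  using inf_nmul_0[of "nmul n u" p m] inf_nmul_0[of p u n] by (simp add: inf_commute)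

text \<open>The identity \<open>b - inf a b + a = sup a b\<close> needs no commutativity. Used with
  \<open>a\<close> and \<open>b\<close> exchanged as well, the lemma shows that disjoint elements
  commute.\<close>

lemma sup_eq_add:
  fixes a b :: 'a
  assumes "inf a b = 0"
  shows "sup a b = b + a"
proof -
  have "b + - inf a b + a = sup b a"
    by (simp add: minus_inf add_sup sup_add add.assoc[symmetric] sup_commute)
  with assms show ?thesis by (simp add: sup_commute)
qed

end

section \<open>Archimedean l-groups\<close>

locale archimedean_l_group = l_group ty for ty :: "'a::{group_add,lattice} itself" +
  assumes archimedean: "\<And>a b :: 'a. 0 \<le> a \<Longrightarrow> (\<And>n. nmul n a \<le> b) \<Longrightarrow> a = 0"
begin

text \<open>If \<open>x\<close> is disjoint from its conjugate \<open>x'\<close> by \<open>b \<ge> 0\<close>, then \<open>b = - x' + b + x \<ge> x - x'\<close> and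
  hence \<open>b \<ge> x\<close>; the same holds for all multiples of \<open>x\<close>.\<close>

lemma conj_disjoint_0_pos:
  fixes x b :: 'a
  assumes "0 \<le> b" "inf x (b + x - b) = 0"
  shows "x = 0"
proof (rule archimedean)
  show "0 \<le> x" using assms(2) by (metis inf_le1)
  fix n
  define y where "y = nmul n x"
  define y' where "y' = b + y - b"
  have "inf y y' = 0"
    using inf_nmul_nmul_0[OF assms(2), of n n] by (simp add: y_def y'_def nmul_conj)
  then have sup: "sup y y' = y' + y" "sup y' y = y + y'"
    by (simp_all add: sup_eq_add inf_commute)
  have "- y' + 0 + y \<le> - y' + b + y"
    using assms(1) by (simp only: add_le_left_iff add_le_right_iff)
  also have "\<dots> = b" by (simp add: y'_def minus_diff_eq diff_conv_add_uminus minus_add add.assoc del: add_uminus_conv_diff)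
  finally have "sup (- y' + y) 0 \<le> b" using assms(1) by simp
  moreover have "sup (- y' + y) 0 = - y' + sup y y'" by (simp add: add_sup)
  moreover have "- y' + sup y y' = y" using sup by (simp add: add.assoc[symmetric])
  ultimately show "nmul n x \<le> b" by (simp only: y_def)
qed

text \<open>Conjugating the hypothesis by \<open>- b\<close> reduces it to a positive
  conjugator.\<close>

lemma conj_disjoint_0_neg:
  fixes x b :: 'a
  assumes "b \<le> 0" "inf x (b + x - b) = 0"
  shows "x = 0"
proof (rule conj_disjoint_0_pos)
  show "0 \<le> - b" using assms(1) by simp
  have "- b + inf x (b + x - b) - - b = 0" using assms(2) by simp
  then show "inf x (- b + x - - b) = 0"
    by (simp only: conj_inf) (simp add: inf_commute add.assoc diff_conv_add_uminus del: add_uminus_conv_diff)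
qed

text \<open>The meet \<open>z\<close> is below \<open>x\<close>, and its conjugate \<open>w\<close>
  by \<open>- b\<close> is below \<open>y\<close>. Thus \<open>z\<close> is disjoint from its own
  conjugate and vanishes.\<close>

lemma disjoint_conj_aux:
  fixes x y b :: 'a
  assumes "inf x y = 0" "0 \<le> b \<or> b \<le> 0"
  shows "inf x (b + y - b) = 0"
proof -
  define z where "z = inf x (b + y - b)"
  define w where "w = - b + z - - b"
  have nn: "0 \<le> x" "0 \<le> y" using assms(1) by (metis inf_le1 inf_le2)+
  then have "0 \<le> b + y - b" using conj_mono[of 0 y b] by simp
  with nn have z0: "0 \<le> z" by (simp add: z_def)
  have "w \<le> - b + (b + y - b) - - b" unfolding w_def by (rule conj_mono) (simp add: z_def)
  also have "\<dots> = y" by (simp add: add.assoc diff_conv_add_uminus del: add_uminus_conv_diff)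
  finally have "w \<le> y" .
  moreover have "0 \<le> w" unfolding w_def using conj_mono[OF z0, of "- b"] by simp
  ultimately have "inf z w = 0"
    using inf_0_mono[OF assms(1) z0] by (simp add: z_def)
  then have "z = 0"
    using assms(2) conj_disjoint_0_pos[of "- b" z] conj_disjoint_0_neg[of "- b" z] unfolding w_def
    by auto
  then show ?thesis by (simp add: z_def)
qed

text \<open>Conjugation by \<open>b\<close> is conjugation by its positive part followed by
  conjugation by \<open>- pp (- b)\<close>, and both of these have a definite sign.\<close>

lemma disjoint_conj:
  fixes x y b :: 'a
  assumes "inf x y = 0"
  shows "inf x (b + y - b) = 0"
proof -
  have n: "- pp (- b) \<le> 0" by simp
  have "pp b = pp (- b) + b" by (simp flip: pp_diff)
  then have b: "b = - pp (- b) + pp b" by (simp add: add.assoc[symmetric])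
  have "inf x (- pp (- b) + (pp b + y - pp b) - - pp (- b)) = 0"
    using n assms by (intro disjoint_conj_aux) auto
  moreover have "- pp (- b) + (pp b + y - pp b) - - pp (- b)
      = (- pp (- b) + pp b) + y - (- pp (- b) + pp b)"
    by (simp add: diff_conv_add_uminus minus_add add.assoc del: add_uminus_conv_diff)
  ultimately show ?thesis using b by simp
qed

end

text \<open>If \<open>s\<close> is the supremum of the multiples of \<open>a\<close>, then
  \<open>- a + s\<close> is an upper bound too, since \<open>a\<close> plus a multiple is again a
  multiple; this forces \<open>a\<close> to be at most 0.\<close>

lemma (in l_group) archimedean_if_sigma_complete:
  assumes "dedekind_sigma_complete TYPE('a)"
  shows "archimedean_l_group TYPE('a)"
proof
  fix a b :: 'a
  assume "0 \<le> a" and le: "\<And>n. nmul n a \<le> b"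
  let ?R = "range (\<lambda>n. nmul n a)"
  have "countable ?R \<and> ?R \<noteq> {} \<and> (\<exists>u. \<forall>y\<in>?R. y \<le> u)" using le by auto
  then obtain s where s: "is_sup_wrt (\<le>) UNIV ?R s"
    using assms unfolding dedekind_sigma_complete_def by blast
  have "nmul n a \<le> - a + s" for n
    using s unfolding is_sup_wrt_def le_minus_add_iff
    by (metis nmul.simps(2) rangeI)
  then have "s \<le> - a + s" using s by (auto simp: is_sup_wrt_def)
  then have "a + s \<le> 0 + s" by (simp add: le_minus_add_iff)
  with \<open>0 \<le> a\<close> show "a = 0" by (simp only: add_le_right_iff)
qed

section \<open>Generic homomorphisms\<close>

context archimedean_l_group
begin

section \<open>Dense sets and generic sequences\<close>

text \<open>Density in the sense of forcing: the conditions are the positive elements, and smaller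
  ones are stronger.\<close>

definition dense_below :: "'a set \<Rightarrow> bool" where
  "dense_below D \<longleftrightarrow> (\<forall>p>0. \<exists>q\<in>D. 0 < q \<and> q \<le> p)"

lemma generic_sequence:
  assumes "countable \<D>" "\<And>D. D \<in> \<D> \<Longrightarrow> dense_below D" "0 < c"
  shows "\<exists>p :: nat \<Rightarrow> 'a. (\<forall>n. 0 < p n \<and> p n \<le> c) \<and> decseq p \<and> (\<forall>D\<in>\<D>. \<exists>n. p n \<in> D)"
proof -
  \<comment> \<open>\<open>UNIV\<close> is dense, and inserting it makes the enumerated family
    nonempty, as \<open>from_nat_into\<close> requires.\<close>
  define e where "e = from_nat_into (insert UNIV \<D>)"
  have "dense_below UNIV" by (auto simp: dense_below_def)
  then have e: "dense_below (e n)" for n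
    using from_nat_into[of "insert UNIV \<D>" n] assms(2) unfolding e_def by auto
  obtain p where p: "\<And>n. (0 < p n \<and> p n \<le> c \<and> p n \<in> e n) \<and> p (Suc n) \<le> p n"
  proof (atomize_elim, rule dependent_nat_choice)
    show "\<exists>q. 0 < q \<and> q \<le> c \<and> q \<in> e 0"
      using e[of 0] \<open>0 < c\<close> unfolding dense_below_def by blast
  next
    fix q n assume q: "0 < q \<and> q \<le> c \<and> q \<in> e n"
    then obtain r where "r \<in> e (Suc n)" "0 < r" "r \<le> q"
      using e[of "Suc n"] unfolding dense_below_def by blast
    with q show "\<exists>r. (0 < r \<and> r \<le> c \<and> r \<in> e (Suc n)) \<and> r \<le> q"
      by (meson order.trans)
  qed
  have "\<exists>n. p n \<in> D" if "D \<in> \<D>" for D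
    using from_nat_into_surj[of "insert UNIV \<D>" D] that assms(1) p unfolding e_def by auto
  with p show ?thesis by (intro exI[of _ p]) (auto simp: decseq_Suc_iff)
qed

lemma diff_mono': "a \<le> b \<Longrightarrow> d \<le> c \<Longrightarrow> a - c \<le> b - d" for a b c d :: 'a
  using add_mono'[of a b "- c" "- d"] by simp

lemma pp_pos_iff: "0 < pp a \<longleftrightarrow> \<not> a \<le> 0"
  using pp_eq_0_iff[of a] pp_nonneg[of a] by (auto simp: less_le)

lemma inf_pp_diff_0: "inf (pp (a - b)) (pp (b - a)) = 0"
  using inf_pp_pp_minus[of "a - b"] by simp

lemma inf_pos:
  fixes p u :: 'a
  shows "0 \<le> p \<Longrightarrow> 0 \<le> u \<Longrightarrow> inf p u \<noteq> 0 \<Longrightarrow> 0 < inf p u"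
  by (simp add: less_le)

text \<open>These sets decide the comparison of \<open>a\<close> and \<open>b\<close>. If
  \<open>p\<close> meets \<open>pp (b - a)\<close>, the meet is a positive element disjoint from
  \<open>pp (a - b)\<close>.\<close>

lemma dense_total: "dense_below {q. inf q (pp (a - b)) = 0 \<or> inf q (pp (b - a)) = 0}"
  unfolding dense_below_def
proof (intro allI impI)
  fix p :: 'a assume p: "0 < p"
  show "\<exists>q\<in>{q. inf q (pp (a - b)) = 0 \<or> inf q (pp (b - a)) = 0}. 0 < q \<and> q \<le> p"
  proof (cases "inf p (pp (b - a)) = 0")
    case True
    with p show ?thesis by auto
  next
    case False
    with p have "0 < inf p (pp (b - a))" by (intro inf_pos) auto
    moreover have "inf (inf p (pp (b - a))) (pp (a - b)) = 0"
      using p by (intro inf_0_mono[OF inf_pp_diff_0]) auto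
    ultimately show ?thesis by (intro bexI[of _ "inf p (pp (b - a))"]) auto
  qed
qed

text \<open>These sets either make \<open>u\<close> at most 0 or bound \<open>h\<close> by a
  multiple of \<open>pp u\<close>. In the second case some multiple of
  \<open>p' = inf p (pp u)\<close> is not below \<open>pp h\<close>, and the witness is taken inside
  the positive part \<open>w\<close> of the excess, where \<open>h\<close> stays below that multiple
  of \<open>pp u\<close>.\<close>

lemma dense_archimedean:
  "dense_below {q. inf q (pp u) = 0 \<or> (\<exists>m. inf q (pp (h - nmul m (pp u))) = 0)}"
  unfolding dense_below_def
proof (intro allI impI)
  fix p :: 'a assume p: "0 < p"
  show "\<exists>q\<in>{q. inf q (pp u) = 0 \<or> (\<exists>m. inf q (pp (h - nmul m (pp u))) = 0)}. 0 < q \<and> q \<le> p"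
  proof (cases "inf p (pp u) = 0")
    case True
    with p show ?thesis by auto
  next
    case False
    define p' where "p' = inf p (pp u)"
    have p': "0 < p'" unfolding p'_def using False p by (intro inf_pos) auto
    then obtain m where m: "\<not> nmul m p' \<le> pp h"
      using archimedean[of p' "pp h"] by (auto simp: less_le)
    define w where "w = pp (nmul m p' - pp h)"
    have w: "0 < w" using m by (simp add: w_def pp_pos_iff diff_le_iff')
    have "nmul m p' - pp h \<le> nmul m p' - 0" by (intro diff_mono') auto
    then have "w \<le> nmul m p'"
      using nmul_nonneg[of p' m] p' by (simp add: w_def pp_def)
    \<comment> \<open>Were \<open>p'\<close> disjoint from \<open>w\<close>, so would be
      \<open>nmul m p'\<close>, which lies above \<open>w\<close>; but \<open>w\<close> is
      positive.\<close>
    then have "inf p' w \<noteq> 0"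
      using inf_nmul_0[of w p' m] w by (auto simp: inf_commute inf_absorb1)
    then have pos: "0 < inf p' w" using p' w by (intro inf_pos) auto
    have "h - nmul m (pp u) \<le> pp h - nmul m p'"
      by (intro diff_mono' nmul_mono') (auto simp: p'_def)
    then have "inf (inf p' w) (pp (h - nmul m (pp u))) = 0"
      using p' w by (intro inf_0_mono[OF inf_pp_diff_0[of "nmul m p'" "pp h"]] pp_mono)
        (auto simp: w_def)
    moreover have "inf p' w \<le> p" by (auto simp: p'_def intro: le_infI1)
    ultimately show ?thesis using pos by (intro bexI[of _ "inf p' w"]) auto
  qed
qed

text \<open>These sets serve continuity: either \<open>r\<close> becomes at most 0, or
  \<open>pp r\<close> is kept from being below some gap \<open>s - y\<close>. For
  \<open>p' = inf p (pp r)\<close> positive, \<open>- p' + s\<close> is not an upper bound of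
  \<open>S\<close>, so \<open>p'\<close> is not below some \<open>s - y\<close>; the positive part
  of \<open>p' - (s - y)\<close> is the witness.\<close>

lemma dense_sup:
  assumes "is_sup_wrt (\<le>) UNIV S s"
  shows "dense_below {q. inf q (pp r) = 0 \<or> (\<exists>y\<in>S. q \<le> pp (pp r - (s - y)))}"
  unfolding dense_below_def
proof (intro allI impI)
  fix p :: 'a assume p: "0 < p"
  show "\<exists>q\<in>{q. inf q (pp r) = 0 \<or> (\<exists>y\<in>S. q \<le> pp (pp r - (s - y)))}. 0 < q \<and> q \<le> p"
  proof (cases "inf p (pp r) = 0")
    case True
    with p show ?thesis by auto
  next
    case False
    define p' where "p' = inf p (pp r)"
    have p': "0 < p'" unfolding p'_def using False p by (intro inf_pos) auto
    have "\<exists>y\<in>S. \<not> p' \<le> s - y"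
    proof (rule ccontr)
      assume "\<not> ?thesis"
      then have "y \<le> - p' + s" if "y \<in> S" for y
        using that by (simp add: le_minus_add_iff le_diff_iff')
      then have "s \<le> - p' + s" using assms by (auto simp: is_sup_wrt_def)
      then have "p' + s \<le> 0 + s" by (simp add: le_minus_add_iff)
      then have "p' \<le> 0" by (simp only: add_le_right_iff)
      with p' show False by auto
    qed
    then obtain y where y: "y \<in> S" "\<not> p' \<le> s - y" by blast
    define w where "w = pp (p' - (s - y))"
    have "0 < w" using y(2) by (simp add: w_def pp_pos_iff diff_le_iff')
    moreover have "w \<le> p"
    proof -
      have "0 \<le> s - y" using assms y(1) by (simp add: le_diff_iff' is_sup_wrt_def)
      then have "p' - (s - y) \<le> p' - 0" by (intro diff_mono') auto
      then have "w \<le> p'" using p' by (simp add: w_def pp_def)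
      then show ?thesis by (simp add: p'_def)
    qed
    moreover have "w \<le> pp (pp r - (s - y))"
      unfolding w_def by (intro pp_mono diff_mono') (auto simp: p'_def)
    ultimately show ?thesis using y(1) by (intro bexI[of _ w]) auto
  qed
qed

section \<open>The preorder of a generic sequence\<close>

definition gle :: "(nat \<Rightarrow> 'a) \<Rightarrow> 'a \<Rightarrow> 'a \<Rightarrow> bool" where
  "gle p a b \<longleftrightarrow> (\<exists>n. inf (p n) (pp (a - b)) = 0)"

context
  fixes p :: "nat \<Rightarrow> 'a"
  assumes p_pos: "\<And>n. 0 < p n" and p_dec: "decseq p"
begin

lemma le_imp_gle: "a \<le> b \<Longrightarrow> gle p a b"
  unfolding gle_def using p_pos[of 0] pp_eq_0_iff[of "a - b"] diff_le_iff'[of a b 0]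
  by (intro exI[of _ 0]) (simp add: inf_absorb2)

text \<open>Disjointness persists at later members of the decreasing sequence, so one index serves
  both hypotheses; the positive part of \<open>a - c\<close> is below the sum of the other
  two.\<close>

lemma gle_trans:
  assumes "gle p a b" "gle p b c"
  shows "gle p a c"
proof -
  obtain m n where mn: "inf (p m) (pp (a - b)) = 0" "inf (p n) (pp (b - c)) = 0"
    using assms by (auto simp: gle_def)
  have le: "0 \<le> p (max m n)" "p (max m n) \<le> p m" "p (max m n) \<le> p n"
    using p_dec p_pos by (auto simp: decseq_def less_imp_le)
  have "inf (p (max m n)) (pp (a - b)) = 0" "inf (p (max m n)) (pp (b - c)) = 0"
    by (rule inf_0_mono[OF mn(1) le(1,2) pp_nonneg order.refl]
        inf_0_mono[OF mn(2) le(1,3) pp_nonneg order.refl])+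
  then have 0: "inf (p (max m n)) (pp (a - b) + pp (b - c)) = 0"
    by (rule inf_add_0)
  have "pp (a - c) \<le> pp (a - b) + pp (b - c)"
    using pp_add_le[of "a - b" "b - c"] by (simp add: add_diff_eq)
  then have "inf (p (max m n)) (pp (a - c)) = 0"
    by (rule inf_0_mono[OF 0 le(1) order.refl pp_nonneg])
  then show ?thesis by (auto simp: gle_def)
qed

lemma gle_right: "gle p a b \<Longrightarrow> gle p (a + c) (b + c)"
  by (simp add: gle_def add.assoc diff_conv_add_uminus minus_add del: add_uminus_conv_diff)

text \<open>Left translation conjugates the difference \<open>a - b\<close>, and
  \<open>disjoint_conj\<close> absorbs the conjugation.\<close>

lemma gle_left:
  assumes "gle p a b"
  shows "gle p (c + a) (c + b)"
proof -
  have "(c + a) - (c + b) = c + (a - b) - c"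
    by (simp add: add.assoc diff_conv_add_uminus minus_add del: add_uminus_conv_diff)
  then show ?thesis
    using assms disjoint_conj by (auto simp: gle_def pp_conj)
qed

text \<open>A member of the sequence below \<open>pp (a - b)\<close> refutes every witness: a later
  member would lie below two disjoint elements, yet be positive.\<close>

lemma not_gle:
  assumes "p n \<le> pp (a - b)"
  shows "\<not> gle p a b"
proof
  assume "gle p a b"
  then obtain m where "inf (p m) (pp (a - b)) = 0" by (auto simp: gle_def)
  moreover have "p (max m n) \<le> p m" "p (max m n) \<le> p n"
    using p_dec by (auto simp: decseq_def)
  then have "p (max m n) \<le> inf (p m) (pp (a - b))" using assms by auto
  ultimately show False using p_pos[of "max m n"] by auto
qed

text \<open>The difference \<open>pp a - a\<close> is \<open>pp (- a)\<close>, so hypothesis and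
  conclusion are the same disjointness.\<close>

lemma pp_gle: "gle p 0 a \<Longrightarrow> gle p (pp a) a"
  by (simp add: gle_def pp_diff pp_eq)

lemma gle_nmul:
  assumes "gle p a b"
  shows "gle p (nmul n a) (nmul n b)"
proof (induction n)
  case (Suc n)
  show ?case using gle_trans[OF gle_right[OF assms] gle_left[OF Suc]] by simp
qed (simp add: le_imp_gle)

text \<open>Both \<open>sup a b - b\<close> and, for the next lemma, \<open>a - inf a b\<close>
  equal \<open>pp (a - b)\<close>. This turns joins and meets into maxima and minima.\<close>

lemma sup_gle: "gle p a b \<Longrightarrow> gle p (sup a b) b"
  using sup_add[of a b "- b"] by (simp add: gle_def pp_eq flip: pp_def)

lemma gle_inf: "gle p a b \<Longrightarrow> gle p a (inf a b)"
  using add_sup[of a "- a" "- b"]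
  by (simp add: gle_def pp_eq diff_conv_add_uminus minus_inf sup_commute[of 0] del: add_uminus_conv_diff
      flip: pp_def)

end

section \<open>Real homomorphisms on a countable subgroup\<close>

text \<open>A generic sequence meets only countably many dense sets, so the laws are confined to
  \<open>H\<close>. As \<open>H\<close> is a subgroup and not necessarily a sublattice, the lattice
  laws carry a membership condition.\<close>

lemma ex_generic_hom:
  assumes H: "countable H" "0 \<in> H" "\<forall>a\<in>H. \<forall>b\<in>H. a + b \<in> H" "\<forall>a\<in>H. - a \<in> H"
    and K: "countable K" "\<forall>(S, s)\<in>K. is_sup_wrt (\<le>) UNIV S s \<and> S \<noteq> {} \<and> S \<subseteq> H \<and> s \<in> H"
    and ab: "a \<in> H" "b \<in> H" "\<not> a \<le> b"
  shows "\<exists>x :: 'a \<Rightarrow> real. (\<forall>c\<in>H. \<forall>d\<in>H. x (c + d) = x c + x d \<and>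
      (sup c d \<in> H \<longrightarrow> x (sup c d) = max (x c) (x d)) \<and>
      (inf c d \<in> H \<longrightarrow> x (inf c d) = min (x c) (x d))) \<and>
    (\<forall>(S, s)\<in>K. is_sup_wrt (\<le>) UNIV (x ` S) (x s)) \<and> x b < x a"
proof -
  \<comment> \<open>The three families give totality, the Archimedean property and continuity at the
    suprema in \<open>K\<close>.\<close>
  let ?tot = "\<lambda>(a, b). {q. inf q (pp (a - b)) = 0 \<or> inf q (pp (b - a)) = 0}"
  let ?arch = "\<lambda>(u, h). {q. inf q (pp u) = 0 \<or> (\<exists>m. inf q (pp (h - nmul m (pp u))) = 0)}"
  let ?sup = "\<lambda>((S, s), r). {q. inf q (pp r) = 0 \<or> (\<exists>y\<in>S. q \<le> pp (pp r - (s - y)))}"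
  define \<D> where "\<D> = ?tot ` (H \<times> H) \<union> ?arch ` (H \<times> H) \<union> ?sup ` (K \<times> H)"
  have countable: "countable \<D>" unfolding \<D>_def using H(1) K(1) by (intro countable_Un countable_image countable_SIGMA) auto
  have dense: "dense_below D" if "D \<in> \<D>" for D
    using that K(2) unfolding \<D>_def by (auto intro!: dense_total dense_archimedean dense_sup)
  \<comment> \<open>Starting below \<open>pp (a - b)\<close> ensures, by \<open>not_gle\<close>,
    that \<open>a\<close> does not become smaller than or equivalent to \<open>b\<close>.\<close>
  have "0 < pp (a - b)" using ab(3) by (simp add: pp_pos_iff diff_le_iff')
  from generic_sequence[OF countable dense this] obtain p where
    p': "(\<forall>n. 0 < p n \<and> p n \<le> pp (a - b)) \<and> decseq p \<and> (\<forall>D\<in>\<D>. \<exists>n. p n \<in> D)" ..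
  have p: "0 < p n" "decseq p" "p n \<le> pp (a - b)" for n
    using p' by simp_all
  have p_gen: "\<exists>n. p n \<in> D" if "D \<in> \<D>" for D
    using p' that by blast
  note gen = le_imp_gle[OF p(1,2)] gle_trans[OF p(1,2)] gle_left[OF p(1,2)] gle_right[OF p(1,2)]
  have total: "gle p c d \<or> gle p d c" if "c \<in> H" "d \<in> H" for c d
  proof -
    have "?tot (c, d) \<in> \<D>" unfolding \<D>_def using that by blast
    from p_gen[OF this] show ?thesis by (auto simp: gle_def)
  qed
  have ab': "\<not> gle p a b" using not_gle[OF p(1,2,3)] .
  \<comment> \<open>Since \<open>gle p a b\<close> fails, \<open>a - b\<close> is strictly positive
    in the preorder and can serve as the unit.\<close>
  define u where "u = a - b"
  interpret archimedean_preordered_group "gle p" H u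
  proof
    show "gle p c c" for c by (simp add: gen)
    show "gle p c e" if "gle p c d" "gle p d e" for c d e using that by (rule gen(2))
    show "\<exists>n. gle p h (nmul n u)" if uh: "u \<in> H" "h \<in> H" and u: "\<not> gle p u 0" for u h
    proof -
      have "?arch (u, h) \<in> \<D>" unfolding \<D>_def using uh by blast
      from p_gen[OF this] obtain n where "p n \<in> ?arch (u, h)" by blast
      moreover have "inf (p n) (pp u) \<noteq> 0" using u by (auto simp: gle_def)
      ultimately obtain m where "inf (p n) (pp (h - nmul m (pp u))) = 0" by auto
      then have "gle p h (nmul m (pp u))" by (auto simp: gle_def)
      moreover have "gle p 0 u" using total[OF uh(1) H(2)] u by blast
      then have "gle p (nmul m (pp u)) (nmul m u)"
        by (intro gle_nmul[OF p(1,2)] pp_gle[OF p(1,2)])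
      ultimately show ?thesis using gen(2) by blast
    qed
    show "\<not> gle p u 0" using ab' gen(4)[of u 0 b] by (auto simp: u_def)
    show "u \<in> H" using H(3,4) ab(1,2) unfolding u_def diff_conv_add_uminus by blast
  qed (use H total gen in auto)
  have sup1: "val (sup c d) = val d" if "c \<in> H" "d \<in> H" "gle p c d" "sup c d \<in> H" for c d
    using val_mono[OF that(4,2) sup_gle[OF p(1,2) that(3)]] val_mono[OF that(2,4) gen(1)] by simp
  have inf1: "val (inf c d) = val c" if "c \<in> H" "d \<in> H" "gle p c d" "inf c d \<in> H" for c d
    using val_mono[OF that(1,4) gle_inf[OF p(1,2) that(3)]] val_mono[OF that(4,1) gen(1)] by simp
  have val_diff: "val (c - d) = val c - val d" if "c \<in> H" "d \<in> H" for c d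
    using val_add[of c "- d"] val_minus[of d] minus_H that by simp
  have diff_H: "c - d \<in> H" if "c \<in> H" "d \<in> H" for c d
    using add_H[of c "- d"] minus_H that by simp
  have val_0: "val 0 = 0" using val_add[of 0 0] zero_H by simp
  show ?thesis
  proof (intro exI[of _ val] conjI ballI impI)
    show "val (c + d) = val c + val d" if "c \<in> H" "d \<in> H" for c d
      using that by (rule val_add)
    show "val (sup c d) = max (val c) (val d)" if "c \<in> H" "d \<in> H" "sup c d \<in> H" for c d
      using total[OF that(1,2)] sup1[of c d] sup1[of d c] val_mono[of c d] val_mono[of d c] that
      by (auto simp: sup_commute[of d])
    show "val (inf c d) = min (val c) (val d)" if "c \<in> H" "d \<in> H" "inf c d \<in> H" for c d
      using total[OF that(1,2)] inf1[of c d] inf1[of d c] val_mono[of c d] val_mono[of d c] that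
      by (auto simp: inf_commute[of d])
    show "val b < val a" using val_le_iff[OF ab(1,2)] ab' by auto
  next
    fix t assume "t \<in> K"
    obtain S s where t: "t = (S, s)" by (cases t)
    with \<open>t \<in> K\<close> have Ss: "(S, s) \<in> K" by simp
    have S: "is_sup_wrt (\<le>) UNIV S s \<and> S \<noteq> {} \<and> S \<subseteq> H \<and> s \<in> H" using K(2) Ss by auto
    have ub: "val y \<le> val s" if "y \<in> S" for y
      using that S by (intro val_mono gen(1)) (auto simp: is_sup_wrt_def)
    \<comment> \<open>The first alternative of the dense set for \<open>(S, s)\<close> and
      \<open>r\<close> would give \<open>gle p r 0\<close>; the second puts \<open>s - y\<close>
      strictly below \<open>r\<close>.\<close>
    have small: "\<exists>y\<in>S. val s - val y < val r" if r: "r \<in> H" "0 < val r" for r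
    proof -
      have r0: "\<not> gle p r 0" using val_le_iff[OF r(1) zero_H] r(2) val_0 by simp
      have "?sup ((S, s), r) \<in> \<D>" unfolding \<D>_def using Ss r(1) by blast
      from p_gen[OF this] obtain n where "p n \<in> ?sup ((S, s), r)" by blast
      moreover have "inf (p n) (pp r) \<noteq> 0" using r0 by (auto simp: gle_def)
      ultimately obtain y where y: "y \<in> S" "p n \<le> pp (pp r - (s - y))" by auto
      then have "\<not> gle p (pp r) (s - y)" by (intro not_gle[OF p(1,2)])
      moreover have "gle p (pp r) r"
        using total[OF r(1) zero_H] r0 by (intro pp_gle[OF p(1,2)]) auto
      ultimately have "\<not> gle p r (s - y)" using gen(2) by blast
      moreover have "y \<in> H" "s \<in> H" using y(1) S by auto
      ultimately have "val (s - y) < val r"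
        using val_le_iff[OF r(1) diff_H[of s y]] by simp
      with y(1) \<open>y \<in> H\<close> \<open>s \<in> H\<close> show ?thesis by (auto simp: val_diff)
    qed
    have "val s \<le> v" if v: "\<And>y. y \<in> S \<Longrightarrow> val y \<le> v" for v
    proof (rule ccontr)
      assume "\<not> val s \<le> v"
      \<comment> \<open>A positive infimum of the gaps \<open>val s - val y\<close> is below every positive value of \<open>val\<close> on \<open>H\<close>,
        hence not attained; but then two gaps closer than the infimum differ by a smaller value.\<close>
      define A where "A = (\<lambda>y. val s - val y) ` S"
      have A_ge: "val s - v \<le> z" if "z \<in> A" for z using that v by (force simp: A_def)
      have "A \<noteq> {}" using S by (simp add: A_def)
      then have pos: "0 < Inf A"
        using cInf_greatest[of A "val s - v"] A_ge \<open>\<not> val s \<le> v\<close> by force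
      have Inf_le: "Inf A \<le> val s - val y" if "y \<in> S" for y
        using that A_ge by (intro cInf_lower bdd_belowI) (auto simp: A_def)
      \<comment> \<open>Every gap is at least \<open>Inf A\<close>, so a gap below
        \<open>2 * Inf A\<close> exceeds any smaller gap by less than \<open>Inf A\<close>.\<close>
      obtain y where y: "y \<in> S" "val s - val y < 2 * Inf A"
        using cInf_lessD[OF \<open>A \<noteq> {}\<close>, of "2 * Inf A"] pos by (auto simp: A_def)
      have SH: "s \<in> H" "\<And>y. y \<in> S \<Longrightarrow> y \<in> H" using S by auto
      have "0 < val (s - y)" using Inf_le[OF y(1)] pos SH y(1) by (simp add: val_diff)
      then obtain y' where y': "y' \<in> S" "val s - val y' < val s - val y"
        using small[OF diff_H[of s y]] SH y(1) by (auto simp: val_diff)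
      then have "0 < val (y' - y)" using SH y(1) by (simp add: val_diff)
      then obtain z where "z \<in> S" "val s - val z < val y' - val y"
        using small[OF diff_H[of y' y]] SH y(1) y'(1) by (auto simp: val_diff)
      with Inf_le[of z] Inf_le[of y'] y y' show False by simp
    qed
    with ub show "case t of (S, s) \<Rightarrow> is_sup_wrt (\<le>) UNIV (val ` S) (val s)"
      by (auto simp: is_sup_wrt_def t)
  qed
qed

end
text \<open>The subgroup consists of the sums of finite words in elements of \<open>T\<close> and
  their negatives; there are countably many such words.\<close>

lemma ex_countable_subgroup:
  fixes T :: "'a::group_add set"
  assumes "countable T"
  shows "\<exists>H. T \<subseteq> H \<and> countable H \<and> 0 \<in> H \<and> (\<forall>a\<in>H. \<forall>b\<in>H. a + b \<in> H) \<and> (\<forall>a\<in>H. - a \<in> H)"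
proof (intro exI conjI ballI)
  let ?T = "T \<union> uminus ` T"
  let ?H = "sum_list ` lists ?T"
  show "T \<subseteq> ?H"
  proof
    fix a assume "a \<in> T"
    then show "a \<in> ?H" by (intro image_eqI[of _ _ "[a]"]) auto
  qed
  show "countable ?H" using assms by auto
  show "0 \<in> ?H" by (rule image_eqI[of _ _ "[]"]) auto
  show "a + b \<in> ?H" if ab: "a \<in> ?H" "b \<in> ?H" for a b
  proof -
    obtain xs ys where "a = sum_list xs" "b = sum_list ys" "xs \<in> lists ?T" "ys \<in> lists ?T"
      using ab by blast
    then show ?thesis by (intro image_eqI[of _ _ "xs @ ys"]) auto
  qed
  show "- a \<in> ?H" if a: "a \<in> ?H" for a
  proof -
    \<comment> \<open>Negation reverses the word because addition need not commute.\<close>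
    have neg: "- sum_list xs = sum_list (rev (map uminus xs))" for xs :: "'a list"
      by (induction xs) (simp_all add: minus_add)
    have T: "- t \<in> ?T" if t: "t \<in> ?T" for t
      using t by auto
    obtain xs where xs: "a = sum_list xs" "xs \<in> lists ?T"
      using a by blast
    have "rev (map uminus xs) \<in> lists ?T"
      using xs(2) T by (simp only: in_lists_conv_set set_rev set_map) blast
    then show ?thesis by (rule image_eqI[rotated]) (simp add: xs(1) neg)
  qed
qed

section \<open>Quotients modulo a sigma-ideal\<close>

context
  fixes X :: "'x set" and I
  assumes I: "sigma_ideal X I"
begin

lemma sigma_ideal_subset: "A \<in> I \<Longrightarrow> B \<subseteq> A \<Longrightarrow> B \<in> I"
  using I unfolding sigma_ideal_def by blast

lemma sigma_ideal_empty: "{} \<in> I"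
  using I unfolding sigma_ideal_def by blast

lemma sigma_ideal_UN: "countable S \<Longrightarrow> (\<And>i. i \<in> S \<Longrightarrow> A i \<in> I) \<Longrightarrow> (\<Union>i\<in>S. A i) \<in> I"
  using I unfolding sigma_ideal_def by (metis (no_types, lifting) countable_image image_subset_iff)

lemma sigma_ideal_Un: "A \<in> I \<Longrightarrow> B \<in> I \<Longrightarrow> A \<union> B \<in> I"
  using sigma_ideal_UN[of "{A, B}" "\<lambda>A. A"] by auto

lemma qclass_eq_iff: "qclass X I f = qclass X I g \<longleftrightarrow> {x\<in>X. f x \<noteq> g x} \<in> I"
proof
  assume "qclass X I f = qclass X I g"
  moreover have "g \<in> qclass X I g" by (simp add: qclass_def sigma_ideal_empty)
  ultimately have "g \<in> qclass X I f" by simp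
  then show "{x\<in>X. f x \<noteq> g x} \<in> I" by (simp add: qclass_def)
next
  assume fg: "{x\<in>X. f x \<noteq> g x} \<in> I"
  have "{x\<in>X. f x \<noteq> h x} \<in> I \<longleftrightarrow> {x\<in>X. g x \<noteq> h x} \<in> I" for h
  proof
    assume "{x\<in>X. f x \<noteq> h x} \<in> I"
    from sigma_ideal_Un[OF fg this] show "{x\<in>X. g x \<noteq> h x} \<in> I"
      by (rule sigma_ideal_subset) auto
  next
    assume "{x\<in>X. g x \<noteq> h x} \<in> I"
    from sigma_ideal_Un[OF fg this] show "{x\<in>X. f x \<noteq> h x} \<in> I"
      by (rule sigma_ideal_subset) auto
  qed
  then show "qclass X I f = qclass X I g" by (simp add: qclass_def)
qed

text \<open>The definition of \<open>qle\<close> asks for some pair of representatives; passing to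
  the given pair adds two sets of \<open>I\<close>.\<close>

lemma qle_iff: "qle X I (qclass X I f) (qclass X I g) \<longleftrightarrow> {x\<in>X. g x < f x} \<in> I"
proof
  assume "qle X I (qclass X I f) (qclass X I g)"
  then obtain f' g' where "{x\<in>X. f x \<noteq> f' x} \<in> I" "{x\<in>X. g x \<noteq> g' x} \<in> I" "{x\<in>X. g' x < f' x} \<in> I"
    by (auto simp: qle_def qclass_eq_iff)
  then have "{x\<in>X. f x \<noteq> f' x} \<union> ({x\<in>X. g x \<noteq> g' x} \<union> {x\<in>X. g' x < f' x}) \<in> I"
    by (intro sigma_ideal_Un)
  then show "{x\<in>X. g x < f x} \<in> I"
    by (rule sigma_ideal_subset) auto
qed (auto simp: qle_def)

text \<open>Suprema may be computed pointwise off a set in \<open>I\<close>. If \<open>g\<close>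
  represents an upper bound, the exceptional sets for the members of \<open>S\<close> are countably
  many, so their union is still in \<open>I\<close>.\<close>

lemma is_sup_qclass:
  assumes "countable S" "{x\<in>X. \<not> is_sup_wrt (\<le>) UNIV ((\<lambda>a. f a x) ` S) (f s x)} \<in> I"
  shows "is_sup_wrt (qle X I) (quot X I) ((\<lambda>a. qclass X I (f a)) ` S) (qclass X I (f s))"
  unfolding is_sup_wrt_def[of "qle X I"]
proof (intro conjI ballI impI)
  show "qclass X I (f s) \<in> quot X I" by (simp add: quot_def)
next
  fix B assume "B \<in> (\<lambda>a. qclass X I (f a)) ` S"
  then obtain y where y: "y \<in> S" "B = qclass X I (f y)" by blast
  have "{x\<in>X. f s x < f y x} \<in> I"
    using assms(2) by (rule sigma_ideal_subset) (use y(1) in \<open>force simp: is_sup_wrt_def\<close>)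
  then show "qle X I B (qclass X I (f s))" by (simp add: y(2) qle_iff)
next
  fix U assume U: "U \<in> quot X I" "\<forall>B\<in>(\<lambda>a. qclass X I (f a)) ` S. qle X I B U"
  then obtain g where g: "U = qclass X I g" by (auto simp: quot_def)
  have "(\<Union>y\<in>S. {x\<in>X. g x < f y x}) \<in> I"
    using assms(1) U(2) by (intro sigma_ideal_UN) (auto simp: g qle_iff)
  from sigma_ideal_Un[OF assms(2) this] have "{x\<in>X. g x < f s x} \<in> I"
    by (rule sigma_ideal_subset) (force simp: is_sup_wrt_def not_less)
  then show "qle X I (qclass X I (f s)) U" by (simp add: g qle_iff)
qed

end

section \<open>The ideal of non-homomorphisms\<close>

definition not_hom :: "'a::{group_add,lattice} \<times> 'a \<Rightarrow> ('a \<Rightarrow> real) set" where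
  "not_hom = (\<lambda>(a, b). {x. \<not> (x (a + b) = x a + x b \<and>
     x (sup a b) = max (x a) (x b) \<and> x (inf a b) = min (x a) (x b))})"

definition not_cont :: "'a::lattice set \<times> 'a \<Rightarrow> ('a \<Rightarrow> real) set" where
  "not_cont = (\<lambda>(S, s). {x. \<not> is_sup_wrt (\<le>) UNIV (x ` S) (x s)})"

definition countable_sups :: "('a::lattice set \<times> 'a) set" where
  "countable_sups = {(S, s). countable S \<and> S \<noteq> {} \<and> is_sup_wrt (\<le>) UNIV S s}"

text \<open>The generated sigma-ideal in explicit form: membership hands over a countable list of
  laws and suprema, to which the generic construction applies.\<close>

definition non_hom_ideal :: "('a::{group_add,lattice} \<Rightarrow> real) set set" where
  "non_hom_ideal = {A. \<exists>T K. countable T \<and> countable K \<and> K \<subseteq> countable_sups \<and>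
     A \<subseteq> \<Union> (not_hom ` T) \<union> \<Union> (not_cont ` K)}"

lemma non_hom_idealI:
  "countable T \<Longrightarrow> countable K \<Longrightarrow> K \<subseteq> countable_sups \<Longrightarrow>
    A \<subseteq> \<Union> (not_hom ` T) \<union> \<Union> (not_cont ` K) \<Longrightarrow> A \<in> non_hom_ideal"
  unfolding non_hom_ideal_def by blast

lemma non_hom_idealE:
  assumes "A \<in> non_hom_ideal"
  obtains T K where "countable T" "countable K" "K \<subseteq> countable_sups"
    "A \<subseteq> \<Union> (not_hom ` T) \<union> \<Union> (not_cont ` K)"
  using assms unfolding non_hom_ideal_def by blast

lemma sigma_ideal_non_hom: "sigma_ideal UNIV non_hom_ideal"
  unfolding sigma_ideal_def
proof (intro conjI ballI allI impI)
  show "{} \<in> non_hom_ideal" by (rule non_hom_idealI[of "{}" "{}"]) auto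
  show "B \<in> non_hom_ideal" if A: "A \<in> non_hom_ideal" and "B \<subseteq> A" for A B :: "('a \<Rightarrow> real) set"
    using A
  proof (rule non_hom_idealE)
    fix T K assume TK: "countable T" "countable K" "K \<subseteq> countable_sups"
      "A \<subseteq> \<Union> (not_hom ` T) \<union> \<Union> (not_cont ` K)"
    show ?thesis
      by (rule non_hom_idealI[OF TK(1-3) order.trans[OF \<open>B \<subseteq> A\<close> TK(4)]])
  qed
  show "\<Union>F \<in> non_hom_ideal" if F: "countable F \<and> F \<subseteq> non_hom_ideal" for F :: "('a \<Rightarrow> real) set set"
  proof -
    have "\<forall>A\<in>F. \<exists>TK. countable (fst TK) \<and> countable (snd TK) \<and> snd TK \<subseteq> countable_sups \<and>
     A \<subseteq> \<Union> (not_hom ` fst TK) \<union> \<Union> (not_cont ` snd TK)"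
    proof
      fix A assume "A \<in> F"
      with F have "A \<in> non_hom_ideal" by blast
      then show "\<exists>TK. countable (fst TK) \<and> countable (snd TK) \<and> snd TK \<subseteq> countable_sups \<and>
          A \<subseteq> \<Union> (not_hom ` fst TK) \<union> \<Union> (not_cont ` snd TK)"
      proof (rule non_hom_idealE)
        fix T K assume "countable T" "countable K" "K \<subseteq> countable_sups"
          "A \<subseteq> \<Union> (not_hom ` T) \<union> \<Union> (not_cont ` K)"
        then show ?thesis by (intro exI[of _ "(T, K)"] conjI) (simp_all only: fst_conv snd_conv)
      qed
    qed
    \<comment> \<open>A cover is chosen for each member of \<open>F\<close>; a countable union of
      countable lists of laws is again countable.\<close>
    from bchoice[OF this] obtain f where
      f: "\<forall>A\<in>F. countable (fst (f A)) \<and> countable (snd (f A)) \<and> snd (f A) \<subseteq> countable_sups \<and>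
        A \<subseteq> \<Union> (not_hom ` fst (f A)) \<union> \<Union> (not_cont ` snd (f A))" ..
    show ?thesis
    proof (rule non_hom_idealI)
      show "countable (\<Union>A\<in>F. fst (f A))" "countable (\<Union>A\<in>F. snd (f A))"
        using F f by auto
      show "(\<Union>A\<in>F. snd (f A)) \<subseteq> countable_sups" using f by blast
      show "\<Union>F \<subseteq> \<Union> (not_hom ` (\<Union>A\<in>F. fst (f A))) \<union> \<Union> (not_cont ` (\<Union>A\<in>F. snd (f A)))"
      proof
        fix x assume "x \<in> \<Union>F"
        then obtain A where "A \<in> F" "x \<in> A" by blast
        with f have "x \<in> \<Union> (not_hom ` fst (f A)) \<union> \<Union> (not_cont ` snd (f A))" by blast
        with \<open>A \<in> F\<close> show "x \<in> \<Union> (not_hom ` (\<Union>A\<in>F. fst (f A))) \<union> \<Union> (not_cont ` (\<Union>A\<in>F. snd (f A)))"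
          by blast
      qed
    qed
  qed
qed simp

lemma not_hom_in_ideal: "not_hom t \<in> non_hom_ideal"
  by (rule non_hom_idealI[of "{t}" "{}"]) auto

lemma not_cont_in_ideal: "t \<in> countable_sups \<Longrightarrow> not_cont t \<in> non_hom_ideal"
  by (rule non_hom_idealI[of "{}" "{t}"]) auto

text \<open>Otherwise a generic \<open>x\<close> with \<open>x b < x a\<close> obeys all the laws of
  a countable cover, yet belongs to the covered set.\<close>

lemma (in archimedean_l_group) separation:
  fixes a b :: 'a
  assumes "{x. x a \<noteq> x b} \<in> non_hom_ideal"
  shows "a \<le> b"
proof (rule ccontr)
  assume ab: "\<not> a \<le> b"
  obtain T K where TK: "countable T" "countable K" "K \<subseteq> countable_sups"
    and sub: "{x. x a \<noteq> x b} \<subseteq> \<Union> (not_hom ` T) \<union> \<Union> (not_cont ` K)"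
    using assms by (rule non_hom_idealE)
  \<comment> \<open>Joins and meets of the listed pairs are included so that the conditional lattice
    laws of \<open>ex_generic_hom\<close> apply to them.\<close>
  let ?T = "{a, b} \<union> (\<Union>(c, d)\<in>T. {c, d, sup c d, inf c d}) \<union> (\<Union>(S, s)\<in>K. insert s S)"
  have "countable (case t of (S, s) \<Rightarrow> insert s S)" if "t \<in> K" for t
    using that TK(3) by (auto simp: countable_sups_def split: prod.split)
  then have cT: "countable ?T"
    by (intro countable_Un countable_UN TK) (auto split: prod.split)
  from ex_countable_subgroup[OF cT] obtain H where H: "?T \<subseteq> H" "countable H" "0 \<in> H"
    "\<forall>a\<in>H. \<forall>b\<in>H. a + b \<in> H" "\<forall>a\<in>H. - a \<in> H"
    by (elim exE conjE) (rule that)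
  have K: "\<forall>(S, s)\<in>K. is_sup_wrt (\<le>) UNIV S s \<and> S \<noteq> {} \<and> S \<subseteq> H \<and> s \<in> H"
  proof clarify
    fix S s assume Ss: "(S, s) \<in> K"
    have "insert s S \<subseteq> ?T" using Ss by blast
    with H(1) have "insert s S \<subseteq> H" by (rule subset_trans[rotated])
    moreover have "(S, s) \<in> countable_sups" using TK(3) Ss by (rule subsetD)
    ultimately show "is_sup_wrt (\<le>) UNIV S s \<and> S \<noteq> {} \<and> S \<subseteq> H \<and> s \<in> H"
      by (simp add: countable_sups_def)
  qed
  have TH: "c \<in> H \<and> d \<in> H \<and> sup c d \<in> H \<and> inf c d \<in> H" if cd: "(c, d) \<in> T" for c d
  proof -
    have "{c, d, sup c d, inf c d} \<subseteq> ?T" using cd by blast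
    with H(1) have "{c, d, sup c d, inf c d} \<subseteq> H" by (rule subset_trans[rotated])
    then show ?thesis by simp
  qed
  have "{a, b} \<subseteq> ?T" by blast
  with H(1) have "{a, b} \<subseteq> H" by (rule subset_trans[rotated])
  then have abH: "a \<in> H" "b \<in> H" by auto
  from ex_generic_hom[OF H(2-5) TK(2) K abH ab] obtain x :: "'a \<Rightarrow> real" where x:
    "\<forall>c\<in>H. \<forall>d\<in>H. x (c + d) = x c + x d \<and>
      (sup c d \<in> H \<longrightarrow> x (sup c d) = max (x c) (x d)) \<and>
      (inf c d \<in> H \<longrightarrow> x (inf c d) = min (x c) (x d))"
    "\<forall>(S, s)\<in>K. is_sup_wrt (\<le>) UNIV (x ` S) (x s)"
    "x b < x a"
    by (elim exE conjE) (rule that)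
  have "x \<notin> not_hom t" if "t \<in> T" for t
    using that TH x(1) by (cases t) (auto simp: not_hom_def)
  moreover have "x \<notin> not_cont t" if "t \<in> K" for t
    using that x(2) by (cases t) (auto simp: not_cont_def)
  moreover have "x \<in> \<Union> (not_hom ` T) \<union> \<Union> (not_cont ` K)"
    by (rule subsetD[OF sub]) (use x(3) in simp)
  ultimately show False by blast
qed

theorem mainTheorem10:
  assumes left_mono: "\<And>a b c :: 'a::{group_add, lattice}. a \<le> b \<Longrightarrow> c + a \<le> c + b"
    and right_mono: "\<And>a b c :: 'a. a \<le> b \<Longrightarrow> a + c \<le> b + c"
    and complete: "dedekind_sigma_complete TYPE('a)"
  shows "\<exists>(X :: ('a \<Rightarrow> real) set) I (\<phi> :: 'a \<Rightarrow> (('a \<Rightarrow> real) \<Rightarrow> real) set).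
           sigma_ideal X I \<and> inj \<phi> \<and> l_morphism X I \<phi> \<and> sigma_continuous X I \<phi>"
proof -
  interpret l_group "TYPE('a)" by standard (fact left_mono right_mono)+
  interpret archimedean_l_group "TYPE('a)" by (rule archimedean_if_sigma_complete[OF complete])
  let ?I = "non_hom_ideal :: ('a \<Rightarrow> real) set set"
  note I = sigma_ideal_non_hom
  define \<phi> :: "'a \<Rightarrow> (('a \<Rightarrow> real) \<Rightarrow> real) set" where "\<phi> a = qclass UNIV ?I (\<lambda>x. x a)" for a
  have "inj \<phi>"
  proof (rule injI)
    fix a b assume "\<phi> a = \<phi> b"
    \<comment> \<open>Each orientation yields one inequality through
      \<open>separation\<close>.\<close>
    then have "{x. x a \<noteq> x b} \<in> ?I" "{x. x b \<noteq> x a} \<in> ?I"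
      using qclass_eq_iff[OF I, of "\<lambda>x. x a" "\<lambda>x. x b"]
        qclass_eq_iff[OF I, of "\<lambda>x. x b" "\<lambda>x. x a"] by (simp_all add: \<phi>_def)
    then show "a = b" using separation order.antisym by blast
  qed
  moreover have "l_morphism UNIV ?I \<phi>"
    unfolding l_morphism_def
  proof (intro conjI allI impI)
    show "\<phi> a \<in> quot UNIV ?I" for a by (simp add: \<phi>_def quot_def)
  next
    fix a b f g assume "f \<in> \<phi> a" "g \<in> \<phi> b"
    then have "{x. x a \<noteq> f x} \<in> ?I" "{x. x b \<noteq> g x} \<in> ?I"
      by (simp_all add: \<phi>_def qclass_def)
    \<comment> \<open>The representatives \<open>f\<close> and \<open>g\<close> are arbitrary.
      Outside these three sets they agree with evaluation at \<open>a\<close> and \<open>b\<close>,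
      and \<open>x\<close> obeys the laws for this pair.\<close>
    then have N: "{x. x a \<noteq> f x} \<union> ({x. x b \<noteq> g x} \<union> not_hom (a, b)) \<in> ?I"
      by (intro sigma_ideal_Un[OF I] not_hom_in_ideal)
    have *: "qclass UNIV ?I h = qclass UNIV ?I k"
      if "{x. h x \<noteq> k x} \<subseteq> {x. x a \<noteq> f x} \<union> ({x. x b \<noteq> g x} \<union> not_hom (a, b))" for h k
      using sigma_ideal_subset[OF I N that] by (simp add: qclass_eq_iff[OF I])
    show "\<phi> (a + b) = qclass UNIV ?I (\<lambda>x. f x + g x)"
      "\<phi> (sup a b) = qclass UNIV ?I (\<lambda>x. max (f x) (g x))"
      "\<phi> (inf a b) = qclass UNIV ?I (\<lambda>x. min (f x) (g x))"
      unfolding \<phi>_def by (rule *; auto simp: not_hom_def)+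
  qed
  moreover have "sigma_continuous UNIV ?I \<phi>"
    unfolding sigma_continuous_def
  proof (intro allI impI)
    fix S :: "'a set" and s
    assume S: "countable S \<and> S \<noteq> {} \<and> is_sup_wrt (\<le>) UNIV S s"
    then have "not_cont (S, s) \<in> ?I"
      by (intro not_cont_in_ideal) (simp add: countable_sups_def)
    then show "is_sup_wrt (qle UNIV ?I) (quot UNIV ?I) (\<phi> ` S) (\<phi> s)"
      using is_sup_qclass[OF I, of S "\<lambda>a x. x a" s] S by (simp add: not_cont_def \<phi>_def[abs_def])
  qed
  ultimately show ?thesis using I by blast
qed

end
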